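(* For every convex-round graph $G$ with at least one edge, we have $\chi_{\mathrm{pcf}}(G)\le 9\chi(G)-12$.
   Context: Graphs are finite and simple. A graph is convex-round if its vertices have a circular ordering such that the (open) neighborhood of every vertex is an interval (a set of consecutive vertices) of the circular ordering. $\chi(G)$ is the chromatic number. A proper conflict-free coloring of $G$ is a proper vertex coloring in which, for every non-isolated vertex $v$, some color appears exactly once in the open neighborhood $N(v)$. $\chi_{\mathrm{pcf}}(G)$ is the least $k$ such that $G$ has a proper conflict-free coloring with $k$ colors. *)

theory Defs
  imports "Graph_Theory.Pair_Digraph"
begin

text \<open>
  A finite simple graph is a \<^locale>\<open>pair_graph\<close>: a finite vertex set together with a symmetric,
  irreflexive relation on it, each undirected edge being represented by its two orientations.
\<close>

definition nbhd :: "'a pair_pre_digraph \<Rightarrow> 'a \<Rightarrow> 'a set" where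
  "nbhd G v = {u. (v, u) \<in> parcs G}"

text \<open>
  A list without repetitions is read circularly, its last entry being followed by its first.
  The empty set counts as an interval, so that isolated vertices are allowed in convex-round graphs.
\<close>

definition circular_interval :: "'a list \<Rightarrow> 'a set \<Rightarrow> bool" where
  "circular_interval xs S \<longleftrightarrow> (\<exists>i m. S = set (take m (rotate i xs)))"

definition convex_round :: "'a pair_pre_digraph \<Rightarrow> bool" where
  "convex_round G \<longleftrightarrow>
     (\<exists>xs. distinct xs \<and> set xs = pverts G \<and>
           (\<forall>v \<in> pverts G. circular_interval xs (nbhd G v)))"

definition proper_coloring :: "'a pair_pre_digraph \<Rightarrow> ('a \<Rightarrow> 'c) \<Rightarrow> bool" where
  "proper_coloring G c \<longleftrightarrow> (\<forall>(u, v) \<in> parcs G. c u \<noteq> c v)"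

definition pcf_coloring :: "'a pair_pre_digraph \<Rightarrow> ('a \<Rightarrow> 'c) \<Rightarrow> bool" where
  "pcf_coloring G c \<longleftrightarrow>
     proper_coloring G c \<and>
     (\<forall>v \<in> pverts G. nbhd G v \<noteq> {} \<longrightarrow> (\<exists>a. \<exists>!u. u \<in> nbhd G v \<and> c u = a))"

definition chromatic_number :: "'a pair_pre_digraph \<Rightarrow> nat" where
  "chromatic_number G =
     (LEAST k. \<exists>c :: 'a \<Rightarrow> nat. c ` pverts G \<subseteq> {..<k} \<and> proper_coloring G c)"

definition pcf_chromatic_number :: "'a pair_pre_digraph \<Rightarrow> nat" where
  "pcf_chromatic_number G =
     (LEAST k. \<exists>c :: 'a \<Rightarrow> nat. c ` pverts G \<subseteq> {..<k} \<and> pcf_coloring G c)"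

text \<open>An injective coloring is proper conflict-free, so both minima are taken over nonempty sets.\<close>

lemma (in pair_graph) pcf_coloring_exists:
  "\<exists>c :: 'a \<Rightarrow> nat. c ` pverts G \<subseteq> {..<card (pverts G)} \<and> pcf_coloring G c"
proof -
  obtain c :: "'a \<Rightarrow> nat" where c: "bij_betw c (pverts G) {0..<card (pverts G)}"
    using ex_bij_betw_finite_nat[OF pair_finite_verts] by blast
  have inj: "x = y" if "c x = c y" "x \<in> pverts G" "y \<in> pverts G" for x y
    using c that by (meson bij_betw_def inj_onD)
  have "c u \<noteq> c v" if "(u, v) \<in> parcs G" for u v
    using inj[of u v] in_arcsD1[OF that] in_arcsD2[OF that] pair_no_loops[OF that] by auto
  then have "proper_coloring G c"
    unfolding proper_coloring_def by blast
  moreover have "\<exists>a. \<exists>!u. u \<in> nbhd G v \<and> c u = a" if ne: "nbhd G v \<noteq> {}" for v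
  proof -
    obtain u where u: "u \<in> nbhd G v"
      using ne by blast
    have "w = u" if "w \<in> nbhd G v" "c w = c u" for w
      using inj[OF that(2)] that(1) u in_arcsD2 unfolding nbhd_def by simp
    with u show ?thesis
      by (intro exI[of _ "c u"] ex1I[of _ u]) simp_all
  qed
  moreover have "c ` pverts G \<subseteq> {..<card (pverts G)}"
    using bij_betw_imp_surj_on[OF c] by (simp add: lessThan_atLeast0)
  ultimately show ?thesis
    unfolding pcf_coloring_def by blast
qed

end

theory Submission
  imports Defs
begin

text \<open>
  Let \<open>P\<close> be an inclusion-minimal set of vertices meeting every nonempty neighborhood. Every
  \<open>p \<in> P\<close> has a private vertex \<open>u\<close>, one with \<open>N(u) \<inter> P = {p}\<close>. If some \<open>N(v)\<close> contained three
  elements of \<open>P\<close>, then their neighborhoods would be circular intervals that all contain \<open>v\<close>, each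
  of them containing exactly one of the three private vertices; but one of these cannot be reached
  from \<open>v\<close> along the circle without passing through another. So every \<open>N(v)\<close> meets \<open>P\<close> in one or
  two elements. If all neighborhoods are intervals of a linear order, then marking \<open>P\<close> alternately
  with two marks, leaving the other vertices unmarked, and pairing this with an optimal proper
  coloring gives \<open>3 \<chi>\<close> colors. This is so if \<open>\<chi> = 2\<close>: two consecutive vertices with a common
  neighbor have the same color, so some consecutive pair has no common neighbor, and the circle can
  be cut there. If \<open>\<chi> \<ge> 3\<close>, a single vertex \<open>q\<close> receives a third mark, which settles the
  neighborhoods containing \<open>q\<close> and makes the others linear; this gives \<open>4 \<chi>\<close> colors.
\<close>

section \<open>Arcs of a circularly read list\<close>

lemma circular_interval_indices:
  assumes "circular_interval xs S"
  obtains r m where "r \<le> length xs" "m \<le> length xs"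
    "S = (!) xs ` {k. k < length xs \<and> (r \<le> k \<and> k < r + m \<or> k + length xs < r + m)}"
proof (cases "xs = []")
  case True
  then show ?thesis
    using assms that[of 0 0] by (simp add: circular_interval_def)
next
  case False
  define n where "n = length xs"
  have n: "n > 0" using False by (simp add: n_def)
  obtain i m0 where S: "S = set (take m0 (rotate i xs))"
    using assms by (auto simp: circular_interval_def)
  \<comment> \<open>Reducing the start below \<open>n\<close> and the length to at most
    \<open>n\<close> leaves a window that wraps past the end of the list at most once.\<close>
  define r where "r = i mod n"
  define m where "m = min m0 n"
  have r: "r < n" using n by (simp add: r_def)
  have "S = set (take m (rotate r xs))"
    unfolding S r_def n_def rotate_conv_mod[of i xs, symmetric] by (simp add: m_def n_def min_def)
  also have "\<dots> = (!) (rotate r xs) ` {..<m}"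
    using nth_image[of m "rotate r xs"] by (simp add: m_def n_def lessThan_atLeast0)
  also have "\<dots> = (\<lambda>t. xs ! ((r + t) mod n)) ` {..<m}"
    by (intro image_cong) (auto simp: nth_rotate m_def n_def)
  also have "\<dots> = (!) xs ` ((\<lambda>t. (r + t) mod n) ` {..<m})"
    by (simp add: image_image)
  also have "(\<lambda>t. (r + t) mod n) ` {..<m} = {k. k < n \<and> (r \<le> k \<and> k < r + m \<or> k + n < r + m)}"
  proof (intro equalityI subsetI)
    fix k assume "k \<in> (\<lambda>t. (r + t) mod n) ` {..<m}"
    then obtain t where t: "t < m" "k = (r + t) mod n" by blast
    show "k \<in> {k. k < n \<and> (r \<le> k \<and> k < r + m \<or> k + n < r + m)}"
    proof (cases "r + t < n")
      case True
      then show ?thesis using t by simp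
    next
      case False
      moreover have "t < n" using t(1) by (simp add: m_def)
      then have "r + t - n < n" using r False by linarith
      ultimately have "k = r + t - n"
        using t(2) by (simp add: le_mod_geq)
      then show ?thesis using t r False by (auto simp: m_def)
    qed
  next
    fix k assume k: "k \<in> {k. k < n \<and> (r \<le> k \<and> k < r + m \<or> k + n < r + m)}"
    show "k \<in> (\<lambda>t. (r + t) mod n) ` {..<m}"
    proof (cases "r \<le> k \<and> k < r + m")
      case True
      then show ?thesis using k by (intro image_eqI[of _ _ "k - r"]) auto
    next
      case False
      then show ?thesis using k r by (intro image_eqI[of _ _ "k + n - r"]) auto
    qed
  qed
  finally show ?thesis
    using that[of r m] r by (simp add: n_def m_def)
qed

text \<open>The window starting at \<open>r\<close> runs round the end of the list between the two
  positions only if \<open>i\<close> lies in its wrapped part and \<open>j\<close> does not;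
  otherwise it covers everything from \<open>i\<close> to \<open>j\<close>.\<close>

lemma circular_interval_arc:
  assumes "circular_interval xs S" "distinct xs"
    and "i \<le> j" "j < length xs" "xs ! i \<in> S" "xs ! j \<in> S"
  shows "(\<forall>k. i \<le> k \<and> k \<le> j \<longrightarrow> xs ! k \<in> S) \<or>
         (\<forall>k. k < length xs \<and> (k \<le> i \<or> j \<le> k) \<longrightarrow> xs ! k \<in> S)"
proof -
  obtain r m where rm: "r \<le> length xs" "m \<le> length xs"
    and S: "S = (!) xs ` {k. k < length xs \<and> (r \<le> k \<and> k < r + m \<or> k + length xs < r + m)}"
    by (rule circular_interval_indices[OF assms(1)])
  have mem: "xs ! k \<in> S \<longleftrightarrow> r \<le> k \<and> k < r + m \<or> k + length xs < r + m" if "k < length xs" for k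
    using that assms(2) unfolding S by (auto simp: nth_eq_iff_index_eq)
  have i: "r \<le> i \<and> i < r + m \<or> i + length xs < r + m"
    and j: "r \<le> j \<and> j < r + m \<or> j + length xs < r + m"
    using mem[of i] mem[of j] assms by auto
  show ?thesis
  proof (cases "i + length xs < r + m \<and> \<not> j + length xs < r + m")
    case True
    have "xs ! k \<in> S" if "k < length xs" "k \<le> i \<or> j \<le> k" for k
      unfolding mem[OF that(1)] using True that i j rm by linarith
    then show ?thesis by blast
  next
    case False
    have "xs ! k \<in> S" if "i \<le> k" "k \<le> j" for k
    proof -
      have "k < length xs" using that assms(4) by simp
      then show ?thesis unfolding mem[OF \<open>k < length xs\<close>] using False that i j by linarith
    qed
    then show ?thesis by blast
  qed
qed

lemma circular_interval_rotate:
  assumes "circular_interval xs S"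
  shows "circular_interval (rotate j xs) S"
proof (cases "xs = []")
  case True
  then show ?thesis using assms by simp
next
  case False
  obtain i m where S: "S = set (take m (rotate i xs))"
    using assms by (auto simp: circular_interval_def)
  \<comment> \<open>Rotating back by \<open>j\<close> is replaced by rotating forward by
    \<open>length xs * j - j\<close>, which completes \<open>j\<close> full turns; this inequality
    keeps the subtraction exact.\<close>
  have "j \<le> length xs * j"
    using False by (cases xs) auto
  then have eq: "i + (length xs * j - j) + j = i + length xs * j" by linarith
  have "rotate (i + (length xs * j - j)) (rotate j xs) = rotate (i + length xs * j) xs"
    unfolding rotate_rotate eq ..
  also have "\<dots> = rotate i xs"
    by (metis mod_mult_self2 rotate_conv_mod)
  finally show ?thesis
    unfolding circular_interval_def S by metis
qed

text \<open>Starting at \<open>v\<close> and going round once, one meets the three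
  \<open>u i\<close> in some order. The middle one is separated from \<open>v\<close> on both sides,
  so its \<open>J i\<close> must contain another \<open>u j\<close>.\<close>

lemma no_three_private_arcs:
  fixes u :: "nat \<Rightarrow> 'a"
  assumes d: "distinct xs" and "v \<in> set xs"
    and u: "\<And>i. i < 3 \<Longrightarrow> u i \<in> set xs" "\<And>i. i < 3 \<Longrightarrow> u i \<noteq> v"
    and J: "\<And>i. i < 3 \<Longrightarrow> circular_interval xs (J i)" "\<And>i. i < 3 \<Longrightarrow> v \<in> J i"
    and uJ: "\<And>i j. i < 3 \<Longrightarrow> j < 3 \<Longrightarrow> u i \<in> J j \<longleftrightarrow> i = j"
  shows False
proof -
  obtain e where e: "e < length xs" "xs ! e = v"
    using \<open>v \<in> set xs\<close> by (meson in_set_conv_nth)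
  have "\<forall>i. \<exists>k. i < (3::nat) \<longrightarrow> k < length xs \<and> xs ! k = u i"
    using u(1) by (meson in_set_conv_nth)
  then obtain a where a: "\<And>i. i < 3 \<Longrightarrow> a i < length xs \<and> xs ! a i = u i" by metis
  have ne: "a i \<noteq> e" if "i < 3" for i
    using a[OF that] u(2)[OF that] e by auto
  \<comment> \<open>\<open>u j\<close> lies on one arc between \<open>u i\<close> and
    \<open>v\<close>, and \<open>u k\<close> on the other; \<open>J i\<close> contains one of the
    two arcs.\<close>
  have blocked: False if "i < 3" "j < 3" "k < 3" "j \<noteq> i" "k \<noteq> i"
    and "min (a i) e \<le> a j" "a j \<le> max (a i) e" "a k \<le> min (a i) e \<or> max (a i) e \<le> a k" for i j k
  proof -
    have "(\<forall>l. min (a i) e \<le> l \<and> l \<le> max (a i) e \<longrightarrow> xs ! l \<in> J i) \<or>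
       (\<forall>l. l < length xs \<and> (l \<le> min (a i) e \<or> max (a i) e \<le> l) \<longrightarrow> xs ! l \<in> J i)"
      by (rule circular_interval_arc[OF J(1)[OF \<open>i < 3\<close>] d])
        (use that a[OF \<open>i < 3\<close>] e uJ[of i i] J(2)[of i] in \<open>auto simp: min_def max_def\<close>)
    then have "u j \<in> J i \<or> u k \<in> J i"
      using that a[of j] a[of k] by auto
    then show False using uJ that by auto
  qed
  have sorted: False
    if lt: "i < 3" "j < 3" "k < 3" and dist: "i \<noteq> j" "j \<noteq> k" "i \<noteq> k"
      and "a i \<le> a j" "a j \<le> a k" for i j k
  proof -
    \<comment> \<open>The position of \<open>v\<close> among the three decides which of them is the
      middle one when counting from \<open>v\<close>; that index is passed first to
      \<open>blocked\<close>.\<close>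
    consider "e < a i" | "a i < e" "e < a j" | "a j < e" "e < a k" | "a k < e"
      using ne[OF lt(1)] ne[OF lt(2)] ne[OF lt(3)] that by linarith
    then show False
    proof cases
      case 1 then show False using blocked[of j i k] lt dist that by auto
    next
      case 2 then show False using blocked[of k j i] lt dist that by auto
    next
      case 3 then show False using blocked[of i j k] lt dist that by auto
    next
      case 4 then show False using blocked[of j k i] lt dist that by auto
    qed
  qed
  consider "a 0 \<le> a 1" "a 1 \<le> a 2" | "a 0 \<le> a 2" "a 2 \<le> a 1" | "a 1 \<le> a 0" "a 0 \<le> a 2"
    | "a 1 \<le> a 2" "a 2 \<le> a 0" | "a 2 \<le> a 0" "a 0 \<le> a 1" | "a 2 \<le> a 1" "a 1 \<le> a 0"
    by linarith
  then show False
  proof cases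
    case 1 then show False by (intro sorted[of 0 1 2]) auto
  next
    case 2 then show False by (intro sorted[of 0 2 1]) auto
  next
    case 3 then show False by (intro sorted[of 1 0 2]) auto
  next
    case 4 then show False by (intro sorted[of 1 2 0]) auto
  next
    case 5 then show False by (intro sorted[of 2 0 1]) auto
  next
    case 6 then show False by (intro sorted[of 2 1 0]) auto
  qed
qed

section \<open>Cutting the circle into a linear order\<close>

definition circular_ordering :: "'a pair_pre_digraph \<Rightarrow> 'a list \<Rightarrow> bool" where
  "circular_ordering G xs \<longleftrightarrow> distinct xs \<and> set xs = pverts G \<and>
     (\<forall>v \<in> pverts G. circular_interval xs (nbhd G v))"

lemma circular_ordering_rotate:
  "circular_ordering G xs \<Longrightarrow> circular_ordering G (rotate j xs)"
  by (simp add: circular_ordering_def circular_interval_rotate)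

definition order_convex :: "'a list \<Rightarrow> 'a set \<Rightarrow> bool" where
  "order_convex xs S \<longleftrightarrow>
     (\<forall>i j k. i \<le> k \<and> k \<le> j \<and> j < length xs \<and> xs ! i \<in> S \<and> xs ! j \<in> S \<longrightarrow> xs ! k \<in> S)"

text \<open>The outer arc of two positions contains both ends of the list, so a set missing an end
  must contain the inner arc.\<close>

lemma order_convex_of_arc:
  assumes "circular_interval xs S" "distinct xs"
    and "\<not> (xs ! 0 \<in> S \<and> xs ! (length xs - 1) \<in> S)"
  shows "order_convex xs S"
  unfolding order_convex_def
proof (intro allI impI; elim conjE)
  fix i j k assume "i \<le> k" "k \<le> j" "j < length xs" "xs ! i \<in> S" "xs ! j \<in> S"
  moreover have "0 < length xs" "length xs - 1 < length xs" "j \<le> length xs - 1"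
    using calculation by auto
  ultimately show "xs ! k \<in> S"
    using circular_interval_arc[OF assms(1,2), of i j] assms(3) le_trans[of i k j] by blast
qed

section \<open>Minimal hitting sets and their markings\<close>

lemma minimal_hitting_set:
  assumes "finite V" and "\<And>v. v \<in> W \<Longrightarrow> N v \<subseteq> V \<and> N v \<noteq> {}"
  obtains P where "P \<subseteq> V" "\<And>v. v \<in> W \<Longrightarrow> N v \<inter> P \<noteq> {}"
    "\<And>p. p \<in> P \<Longrightarrow> \<exists>u \<in> W. N u \<inter> P = {p}"
proof -
  define H where "H = {P. P \<subseteq> V \<and> (\<forall>v \<in> W. N v \<inter> P \<noteq> {})}"
  have "finite H" using assms(1) by (simp add: H_def)
  moreover have "V \<in> H" using assms(2) by (auto simp: H_def)
  ultimately obtain P where P: "P \<in> H" and min: "\<And>Q. Q \<in> H \<Longrightarrow> Q \<subseteq> P \<Longrightarrow> P = Q"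
    using finite_has_minimal[of H] by blast
  have "\<exists>u \<in> W. N u \<inter> P = {p}" if "p \<in> P" for p
  proof -
    \<comment> \<open>By minimality, removing \<open>p\<close> leaves some \<open>N u\<close> unhit,
      and this \<open>N u\<close> meets \<open>P\<close> in \<open>p\<close> alone.\<close>
    have "P - {p} \<notin> H" using min[of "P - {p}"] that by blast
    then obtain u where u: "u \<in> W" "N u \<inter> (P - {p}) = {}"
      using P by (auto simp: H_def)
    moreover have "N u \<inter> P \<noteq> {}" using P u by (auto simp: H_def)
    ultimately have "N u \<inter> P = {p}" by blast
    with u show ?thesis by blast
  qed
  with P that show ?thesis by (auto simp: H_def)
qed

context pair_graph
begin

lemma nbhd_sym: "u \<in> nbhd G v \<longleftrightarrow> v \<in> nbhd G u"
  using arcs_symmetric by (auto simp: nbhd_def)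

lemma nbhd_subset: "nbhd G v \<subseteq> pverts G"
  using in_arcsD2 by (auto simp: nbhd_def)

lemma card_nbhd_private_le_2:
  assumes xs: "circular_ordering G xs" and v: "v \<in> pverts G"
    and P: "P \<subseteq> pverts G" "\<And>p. p \<in> P \<Longrightarrow> \<exists>u \<in> pverts G. nbhd G u \<inter> P = {p}"
  shows "card (nbhd G v \<inter> P) \<le> 2"
proof (rule ccontr)
  assume "\<not> card (nbhd G v \<inter> P) \<le> 2"
  then obtain T where T: "T \<subseteq> nbhd G v \<inter> P" "card T = 3"
    using obtain_subset_with_card_n[of 3 "nbhd G v \<inter> P"] by (metis not_less_eq_eq numeral_2_eq_2 numeral_3_eq_3)
  then have "finite T" by (metis card.infinite zero_neq_numeral)
  then obtain p :: "nat \<Rightarrow> 'a" where p: "bij_betw p {0..<3} T"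
    using ex_bij_betw_nat_finite[of T] T(2) by auto
  have pT: "p i \<in> T" if "i < 3" for i
    using p that by (auto simp: bij_betw_def)
  have inj: "p i = p j \<longleftrightarrow> i = j" if "i < 3" "j < 3" for i j
    using p that by (auto simp: bij_betw_def dest: inj_onD)
  have "\<forall>i. \<exists>u. i < 3 \<longrightarrow> u \<in> pverts G \<and> nbhd G u \<inter> P = {p i}"
    using P(2) pT T(1) by blast
  then obtain u where u: "\<And>i. i < 3 \<Longrightarrow> u i \<in> pverts G \<and> nbhd G (u i) \<inter> P = {p i}"
    by metis
  show False
  proof (rule no_three_private_arcs[of xs v u "\<lambda>i. nbhd G (p i)"])
    show "distinct xs" "v \<in> set xs" using xs v by (auto simp: circular_ordering_def)
    show "u i \<in> set xs" if "i < 3" for i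
      using u[OF that] xs by (simp add: circular_ordering_def)
    show "u i \<noteq> v" if "i < 3" for i
    proof
      \<comment> \<open>\<open>v\<close> sees all three elements of \<open>T\<close>, a private
        vertex only one.\<close>
      assume "u i = v"
      then have "T \<subseteq> {p i}" using u[OF that] T(1) by blast
      then have "card T \<le> 1" using card_mono[of "{p i}" T] by simp
      with T(2) show False by simp
    qed
    show "circular_interval xs (nbhd G (p i))" if "i < 3" for i
      using pT[OF that] T(1) P(1) xs by (auto simp: circular_ordering_def)
    show "v \<in> nbhd G (p i)" if "i < 3" for i
      using pT[OF that] T(1) nbhd_sym by blast
    show "u i \<in> nbhd G (p j) \<longleftrightarrow> i = j" if "i < 3" "j < 3" for i j
    proof -
      have "p j \<in> P" using pT[OF that(2)] T(1) by blast
      then have "p j \<in> nbhd G (u i) \<longleftrightarrow> p j = p i" using u[OF that(1)] by blast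
      then show ?thesis using nbhd_sym inj[OF that] by auto
    qed
  qed
qed

text \<open>The set \<open>W\<close> is a parameter so that neighborhoods settled by other means,
  which may fail to be convex in the list order, can be left out.\<close>

lemma marking_exists:
  assumes xs: "circular_ordering G xs"
    and W: "W \<subseteq> pverts G" "\<And>v. v \<in> W \<Longrightarrow> nbhd G v \<noteq> {}"
    and lin: "\<And>v. v \<in> W \<Longrightarrow> order_convex xs (nbhd G v)"
  obtains t :: "'a \<Rightarrow> nat" where "\<And>u. t u < 3" "\<And>v. v \<in> W \<Longrightarrow> \<exists>a. \<exists>!u. u \<in> nbhd G v \<and> t u = a"
proof -
  have d: "distinct xs" and set: "set xs = pverts G"
    using xs by (auto simp: circular_ordering_def)
  obtain P where P: "P \<subseteq> pverts G" "\<And>v. v \<in> W \<Longrightarrow> nbhd G v \<inter> P \<noteq> {}"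
    "\<And>p. p \<in> P \<Longrightarrow> \<exists>u \<in> W. nbhd G u \<inter> P = {p}"
    using minimal_hitting_set[of "pverts G" W "nbhd G"] nbhd_subset W(2) pair_finite_verts by metis
  have le2: "card (nbhd G v \<inter> P) \<le> 2" if "v \<in> pverts G" for v
    using card_nbhd_private_le_2[OF xs that P(1)] P(3) W(1) by blast
  \<comment> \<open>The parity of \<open>rank\<close> alternates along \<open>P\<close>, giving the
    marks 1 and 2; mark 0 is reserved for vertices outside \<open>P\<close>.\<close>
  define rank where "rank k = card {i. i < k \<and> xs ! i \<in> P}" for k
  define t where "t u = (if u \<in> P then 1 + rank (inv_into {..<length xs} ((!) xs) u) mod 2 else 0)" for u
  have t: "t (xs ! k) = 1 + rank k mod 2" if "k < length xs" "xs ! k \<in> P" for k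
  proof -
    have "inj_on ((!) xs) {..<length xs}" using d by (simp add: inj_on_nth)
    then show ?thesis using that by (simp add: t_def)
  qed
  have "\<exists>a. \<exists>!u. u \<in> nbhd G v \<and> t u = a" if v: "v \<in> W" for v
  proof -
    have fin: "finite (nbhd G v \<inter> P)"
      using P(1) pair_finite_verts finite_subset by blast
    obtain j where j: "j < length xs" "xs ! j \<in> nbhd G v \<inter> P"
      using P(1,2) v set by (metis IntD2 all_not_in_conv in_set_conv_nth subsetD)
    have two: "t (xs ! k) \<noteq> t (xs ! l)"
      if kl: "k < l" "l < length xs" "xs ! k \<in> nbhd G v \<inter> P" "xs ! l \<in> nbhd G v \<inter> P" for k l
    proof -
      \<comment> \<open>By convexity, an element of \<open>P\<close> in between would be a third one
        in the neighborhood. Hence \<open>k\<close> and \<open>l\<close> are consecutive in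
        \<open>P\<close> and their ranks differ by one.\<close>
      have gap: "xs ! i \<notin> P" if "k < i" "i < l" for i
      proof
        assume "xs ! i \<in> P"
        moreover have "xs ! i \<in> nbhd G v"
          using lin[OF v] kl that unfolding order_convex_def
          by (meson IntD1 less_imp_le)
        ultimately have "{xs ! k, xs ! i, xs ! l} \<subseteq> nbhd G v \<inter> P" using kl by blast
        then have "card {xs ! k, xs ! i, xs ! l} \<le> 2"
          using card_mono[OF fin] le2 v W(1) by (meson le_trans subsetD)
        moreover have "xs ! k \<noteq> xs ! i" "xs ! k \<noteq> xs ! l" "xs ! i \<noteq> xs ! l"
          using d kl that by (auto simp: nth_eq_iff_index_eq)
        ultimately show False by simp
      qed
      have "i < k \<or> i = k" if "i < l" "xs ! i \<in> P" for i
        using gap[of i] that by linarith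
      then have "{i. i < l \<and> xs ! i \<in> P} = insert k {i. i < k \<and> xs ! i \<in> P}"
        using kl by auto
      then have "rank l = Suc (rank k)" by (simp add: rank_def)
      then show ?thesis using kl t[of k] t[of l] by (simp add: mod_Suc)
    qed
    have "t u \<noteq> t (xs ! j)" if "u \<in> nbhd G v" "u \<noteq> xs ! j" for u
    proof (cases "u \<in> P")
      case True
      then obtain i where i: "i < length xs" "xs ! i = u"
        using P(1) set by (metis in_set_conv_nth subsetD)
      then have "i \<noteq> j" using that by auto
      then consider "i < j" | "j < i" by linarith
      then show ?thesis
        by cases (use two[of i j] two[of j i] i j that True in auto)
    next
      case False
      then show ?thesis using t[OF j(1)] j by (simp add: t_def)
    qed
    then show ?thesis using j by blast
  qed
  moreover have "t u < 3" for u
    by (simp add: t_def)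
  ultimately show ?thesis using that by blast
qed

section \<open>From markings to proper conflict-free colorings\<close>

lemma optimal_coloring:
  obtains c :: "'a \<Rightarrow> nat" where "c ` pverts G \<subseteq> {..<chromatic_number G}" "proper_coloring G c"
proof -
  have "\<exists>k. \<exists>c :: 'a \<Rightarrow> nat. c ` pverts G \<subseteq> {..<k} \<and> proper_coloring G c"
    using pcf_coloring_exists unfolding pcf_coloring_def by blast
  from LeastI_ex[OF this] that show ?thesis
    unfolding chromatic_number_def by blast
qed

lemma pcf_chromatic_number_le:
  fixes t :: "'a \<Rightarrow> nat"
  assumes t: "\<And>u. t u < s"
    and uniq: "\<And>v. v \<in> pverts G \<Longrightarrow> nbhd G v \<noteq> {} \<Longrightarrow> \<exists>a. \<exists>!u. u \<in> nbhd G v \<and> t u = a"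
  shows "pcf_chromatic_number G \<le> s * chromatic_number G"
proof -
  define n where "n = chromatic_number G"
  obtain c :: "'a \<Rightarrow> nat" where c: "c ` pverts G \<subseteq> {..<n}" "proper_coloring G c"
    using optimal_coloring n_def by metis
  \<comment> \<open>The pair of mark and color in base \<open>n\<close>: the color makes
    \<open>f\<close> proper, and a mark unique in a neighborhood makes the whole pair unique
    there.\<close>
  define f where "f u = t u * n + c u" for u
  have f: "f u div n = t u" "f u mod n = c u" if "u \<in> pverts G" for u
    using c(1) that by (auto simp: f_def)
  have "f u < s * n" if "u \<in> pverts G" for u
  proof -
    have "f u < Suc (t u) * n" using c(1) that by (auto simp: f_def)
    also have "\<dots> \<le> s * n" using t[of u] by (intro mult_right_mono) auto
    finally show ?thesis .
  qed
  moreover have "proper_coloring G f"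
    unfolding proper_coloring_def
  proof (clarify)
    fix u v assume "(u, v) \<in> parcs G" "f u = f v"
    then show False
      using c(2) f(2)[of u] f(2)[of v] in_arcsD1 in_arcsD2 by (fastforce simp: proper_coloring_def)
  qed
  moreover have "\<exists>a. \<exists>!u. u \<in> nbhd G v \<and> f u = a" if v: "v \<in> pverts G" "nbhd G v \<noteq> {}" for v
  proof -
    obtain u where u: "u \<in> nbhd G v" "\<And>w. w \<in> nbhd G v \<Longrightarrow> t w = t u \<Longrightarrow> w = u"
      using uniq[OF v] by metis
    have "w = u" if "w \<in> nbhd G v" "f w = f u" for w
      using that u f(1) nbhd_subset by (metis subsetD)
    with u(1) show ?thesis by blast
  qed
  ultimately have "f ` pverts G \<subseteq> {..<s * n} \<and> pcf_coloring G f"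
    by (auto simp: pcf_coloring_def)
  then show ?thesis
    unfolding pcf_chromatic_number_def n_def by (intro Least_le) blast
qed

lemma chromatic_number_ge_2:
  assumes "parcs G \<noteq> {}"
  shows "chromatic_number G \<ge> 2"
proof -
  obtain c :: "'a \<Rightarrow> nat" where c: "c ` pverts G \<subseteq> {..<chromatic_number G}" "proper_coloring G c"
    using optimal_coloring by metis
  obtain u v where uv: "(u, v) \<in> parcs G" using assms by auto
  then have "c u \<noteq> c v" using c(2) by (auto simp: proper_coloring_def)
  moreover have "c u < chromatic_number G" "c v < chromatic_number G"
    using c(1) in_arcsD1[OF uv] in_arcsD2[OF uv] by auto
  ultimately show ?thesis by linarith
qed

section \<open>The bipartite case and the general bound\<close>

lemma pcf_le_three_times_of_bipartite:
  assumes xs: "circular_ordering G xs" and "parcs G \<noteq> {}" and two: "chromatic_number G = 2"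
  shows "pcf_chromatic_number G \<le> 3 * chromatic_number G"
proof -
  obtain c :: "'a \<Rightarrow> nat" where c: "c ` pverts G \<subseteq> {..<2}" "proper_coloring G c"
    using optimal_coloring two by metis
  have set: "set xs = pverts G" using xs by (simp add: circular_ordering_def)
  obtain u v where uv: "(u, v) \<in> parcs G" using assms(2) by auto
  \<comment> \<open>All neighbors of \<open>w\<close> take the only color other than
    \<open>c w\<close>.\<close>
  have same: "c x = c y" if "x \<in> nbhd G w" "y \<in> nbhd G w" for x y w
  proof -
    have "c x \<noteq> c w" "c y \<noteq> c w" using that c(2) by (auto simp: nbhd_def proper_coloring_def)
    moreover have "x \<in> pverts G" "y \<in> pverts G" "w \<in> pverts G"
      using that nbhd_subset nbhd_sym by blast+
    then have "c x < 2" "c y < 2" "c w < 2" using c(1) by auto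
    ultimately show ?thesis by linarith
  qed
  \<comment> \<open>Otherwise the color would be constant along the list, contradicting the edge
    from \<open>u\<close> to \<open>v\<close>.\<close>
  have "\<exists>i. Suc i < length xs \<and> (\<forall>w. \<not> (xs ! i \<in> nbhd G w \<and> xs ! Suc i \<in> nbhd G w))"
  proof (rule ccontr)
    assume "\<not> ?thesis"
    then have step: "c (xs ! i) = c (xs ! Suc i)" if "Suc i < length xs" for i
      using that same by blast
    have const: "c (xs ! i) = c (xs ! 0)" if "i < length xs" for i
      using that
    proof (induction i)
      case (Suc i)
      then show ?case using step[of i] by simp
    qed simp
    have "u \<in> set xs" "v \<in> set xs" using uv in_arcsD1 in_arcsD2 set by auto
    then have "c u = c v" using const by (metis in_set_conv_nth)
    then show False using uv c(2) by (auto simp: proper_coloring_def)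
  qed
  then obtain i where i: "Suc i < length xs"
    and cut: "\<And>w. \<not> (xs ! i \<in> nbhd G w \<and> xs ! Suc i \<in> nbhd G w)" by blast
  \<comment> \<open>This rotation makes the cut pair the last and the first entry, so no
    neighborhood contains both ends.\<close>
  define ys where "ys = rotate (Suc i) xs"
  have ys: "circular_ordering G ys"
    unfolding ys_def by (rule circular_ordering_rotate[OF xs])
  have "rotate (Suc i) xs ! 0 = xs ! ((Suc i + 0) mod length xs)"
    using i by (intro nth_rotate) auto
  then have hd: "ys ! 0 = xs ! Suc i" using i by (simp add: ys_def)
  have "rotate (Suc i) xs ! (length xs - 1) = xs ! ((Suc i + (length xs - 1)) mod length xs)"
    using i by (intro nth_rotate) auto
  moreover have "Suc i + (length xs - 1) = i + length xs" using i by simp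
  ultimately have last: "ys ! (length ys - 1) = xs ! i" using i by (simp add: ys_def)
  have lin: "order_convex ys (nbhd G w)" if "w \<in> pverts G" for w
    using order_convex_of_arc[of ys "nbhd G w"] ys that cut[of w] hd last
    by (auto simp: circular_ordering_def)
  obtain t :: "'a \<Rightarrow> nat" where "\<And>u. t u < 3"
    "\<And>w. w \<in> {w \<in> pverts G. nbhd G w \<noteq> {}} \<Longrightarrow> \<exists>a. \<exists>!u. u \<in> nbhd G w \<and> t u = a"
    by (rule marking_exists[OF ys, of "{w \<in> pverts G. nbhd G w \<noteq> {}}"]) (use lin in auto)
  then show ?thesis by (intro pcf_chromatic_number_le[of t]) simp_all
qed

lemma pcf_le_four_times:
  assumes xs: "circular_ordering G xs"
  shows "pcf_chromatic_number G \<le> 4 * chromatic_number G"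
proof -
  \<comment> \<open>As \<open>q\<close> is an end of the list, the neighborhoods avoiding it are
    convex in the list order.\<close>
  define q where "q = xs ! 0"
  define W where "W = {w \<in> pverts G. nbhd G w \<noteq> {} \<and> q \<notin> nbhd G w}"
  have lin: "order_convex xs (nbhd G w)" if "w \<in> W" for w
    using order_convex_of_arc[of xs "nbhd G w"] xs that
    by (auto simp: circular_ordering_def W_def q_def)
  obtain t :: "'a \<Rightarrow> nat" where t: "\<And>u. t u < 3"
    "\<And>w. w \<in> W \<Longrightarrow> \<exists>a. \<exists>!u. u \<in> nbhd G w \<and> t u = a"
    by (rule marking_exists[OF xs, of W]) (use lin in \<open>auto simp: W_def\<close>)
  show ?thesis
  proof (rule pcf_chromatic_number_le)
    show "(t(q := 3)) u < 4" for u using t(1)[of u] by simp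
    fix w assume w: "w \<in> pverts G" "nbhd G w \<noteq> {}"
    show "\<exists>a. \<exists>!u. u \<in> nbhd G w \<and> (t(q := 3)) u = a"
    proof (cases "q \<in> nbhd G w")
      case True
      \<comment> \<open>The new mark 3 occurs at \<open>q\<close> only, so it is unique in every
        neighborhood containing \<open>q\<close>.\<close>
      moreover have "t u \<noteq> 3" for u using t(1)[of u] by simp
      ultimately show ?thesis by (intro exI[of _ 3] ex1I[of _ q]) (auto split: if_splits)
    next
      case False
      then have "u \<in> nbhd G w \<and> (t(q := 3)) u = a \<longleftrightarrow> u \<in> nbhd G w \<and> t u = a" for u a by auto
      then show ?thesis using t(2)[of w] w False by (simp add: W_def)
    qed
  qed
qed

end

theorem theorem1p5:
  fixes G :: "'a pair_pre_digraph"
  assumes "pair_graph G"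
    and "convex_round G"
    and "parcs G \<noteq> {}"
  shows "int (pcf_chromatic_number G) \<le> 9 * int (chromatic_number G) - 12"
proof -
  interpret pair_graph G by fact
  obtain xs where xs: "circular_ordering G xs"
    using assms(2) by (auto simp: convex_round_def circular_ordering_def)
  show ?thesis
  \<comment> \<open>For chromatic number k = 2 the claimed bound is 6 = 3k; for k at least 3, 4k is
    at most 9k - 12.\<close>
  proof (cases "chromatic_number G = 2")
    case True
    then show ?thesis using pcf_le_three_times_of_bipartite[OF xs assms(3)] by simp
  next
    case False
    then show ?thesis using pcf_le_four_times[OF xs] chromatic_number_ge_2[OF assms(3)] by simp
  qed
qed

end
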